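(* Consider the linear program of minimizing $$f^{\mathrm{inv}}(u^{\mathrm{inv}})+\sum_{t\in\mathcal T}\left(C^{\mathrm p}p_t+C^{\mathrm{nl}}u_t\right)+\sum_{t\in\mathcal T^0}\left(C^{\mathrm{su}}v_t+C^{\mathrm{sd}}w_t\right)$$ over all real $(p,u,v,w)\in\mathbb R^{\mathcal T}\times\mathbb R^{\mathcal T}\times\mathbb R^{\mathcal T^0}\times\mathbb R^{\mathcal T^0}$ satisfying $$\underline P\,u_t\le p_t\le\overline P\,u_t,\quad p_t\ge 0,\quad 0\le u_t\le 1\qquad\forall t\in\mathcal T,$$ $$v_t\ge u_t-u_{t-1},\quad w_t\ge u_{t-1}-u_t,\quad 0\le v_t\le 1,\quad 0\le w_t\le 1\qquad\forall t\in\mathcal T^0 .$$ If $C^{\mathrm{su}}>0$ and $C^{\mathrm{sd}}>0$, then every optimal solution of this linear program satisfies $$u_t-u_{t-1}=v_t-w_t\qquad\forall t\in\mathcal T^0 .$$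
   Context: Single-unit unit commitment problem (no demand balance constraint). $\mathcal T=\{t_0,t_0+1,\dots,t_{end}\}$ is a finite set of consecutive time periods and $\mathcal T^0=\mathcal T\setminus\{t_0\}$. $0\le\underline P\le\overline P$ are the minimum and maximum output; $C^{\mathrm p},C^{\mathrm{nl}},C^{\mathrm{su}},C^{\mathrm{sd}}$ are the nonnegative production, non-load, start-up and shut-down costs. The variables $p_t,u_t,v_t,w_t$ are production, commitment status, start-up and shut-down in period $t$. The investment variable $u^{\mathrm{inv}}$ does not occur in the constraints of this (operational) model, so the term $f^{\mathrm{inv}}(u^{\mathrm{inv}})$ is a constant. The linear program is the LP relaxation of the model ("Model II-S") in which $u_t,v_t,w_t\in\{0,1\}$. *)

theory Defs
  imports Complex_Main
begin

text \<open>
  A point is a quadruple \<open>(p, u, v, w)\<close> of production, commitment, start-up and shut-down.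
  Vectors over a set of periods are total functions on \<^typ>\<open>int\<close>; neither the constraints nor
  the objective read \<open>p\<close>, \<open>u\<close> outside \<open>{t0..t_end}\<close> or \<open>v\<close>, \<open>w\<close> outside \<open>{t0<..t_end}\<close>.
\<close>

type_synonym uc_point =
  "(int \<Rightarrow> real) \<times> (int \<Rightarrow> real) \<times> (int \<Rightarrow> real) \<times> (int \<Rightarrow> real)"

definition periods :: "int \<Rightarrow> int \<Rightarrow> int set" where
  "periods t0 t_end = {t0..t_end}"

definition periods0 :: "int \<Rightarrow> int \<Rightarrow> int set" where
  "periods0 t0 t_end = periods t0 t_end - {t0}"

definition uc_lp_feasible :: "int \<Rightarrow> int \<Rightarrow> real \<Rightarrow> real \<Rightarrow> uc_point \<Rightarrow> bool" where
  "uc_lp_feasible t0 t_end Pmin Pmax = (\<lambda>(p, u, v, w).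
     (\<forall>t\<in>periods t0 t_end.
        Pmin * u t \<le> p t \<and> p t \<le> Pmax * u t \<and> 0 \<le> p t \<and> 0 \<le> u t \<and> u t \<le> 1) \<and>
     (\<forall>t\<in>periods0 t0 t_end.
        u t - u (t - 1) \<le> v t \<and> u (t - 1) - u t \<le> w t \<and>
        0 \<le> v t \<and> v t \<le> 1 \<and> 0 \<le> w t \<and> w t \<le> 1))"

definition uc_cost ::
  "('i \<Rightarrow> real) \<Rightarrow> 'i \<Rightarrow> int \<Rightarrow> int \<Rightarrow> real \<Rightarrow> real \<Rightarrow> real \<Rightarrow> real \<Rightarrow> uc_point \<Rightarrow> real" where
  "uc_cost f_inv u_inv t0 t_end Cp Cnl Csu Csd = (\<lambda>(p, u, v, w).
     f_inv u_inv
     + (\<Sum>t\<in>periods t0 t_end. Cp * p t + Cnl * u t)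
     + (\<Sum>t\<in>periods0 t0 t_end. Csu * v t + Csd * w t))"

end

theory Submission
  imports Defs
begin

text \<open>
  With \<open>p\<close> and \<open>u\<close> held fixed, the constraints bound \<open>v t\<close> and \<open>w t\<close> from below by the positive
  parts of \<open>u t - u (t - 1)\<close> and of its negative, separately for each period. These lower bounds are
  themselves feasible: a difference of two numbers in \<open>[0, 1]\<close> is at most 1. As the coefficients of
  \<open>v t\<close> and \<open>w t\<close> in the cost are positive, an optimal solution must attain both bounds in every
  period, and the claim becomes the identity \<open>x = max 0 x - max 0 (- x)\<close>.
\<close>

lemma uc_lp_feasible_positive_parts:
  assumes "uc_lp_feasible t0 t_end Pmin Pmax (p, u, v, w)"
  shows "uc_lp_feasible t0 t_end Pmin Pmax
           (p, u, \<lambda>t. max 0 (u t - u (t - 1)), \<lambda>t. max 0 (u (t - 1) - u t))"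
proof -
  have "u t - u (t - 1) \<le> 1 \<and> u (t - 1) - u t \<le> 1" if "t \<in> periods0 t0 t_end" for t
  proof -
    have "t \<in> periods t0 t_end" "t - 1 \<in> periods t0 t_end"
      using that by (auto simp: periods0_def periods_def)
    then have "0 \<le> u t \<and> u t \<le> 1" "0 \<le> u (t - 1) \<and> u (t - 1) \<le> 1"
      using assms unfolding uc_lp_feasible_def by blast+
    then show ?thesis by linarith
  qed
  then show ?thesis
    using assms by (auto simp: uc_lp_feasible_def)
qed

theorem mainTheorem3:
  fixes t0 t_end :: int
    and Pmin Pmax Cp Cnl Csu Csd :: real
    and f_inv :: "'i \<Rightarrow> real" and u_inv :: 'i
    and p u v w :: "int \<Rightarrow> real"
  assumes "t0 \<le> t_end"
    and "0 \<le> Pmin" and "Pmin \<le> Pmax"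
    and "0 \<le> Cp" and "0 \<le> Cnl" and "0 \<le> Csu" and "0 \<le> Csd"
    and "Csu > 0" and "Csd > 0"
    and "is_arg_min (uc_cost f_inv u_inv t0 t_end Cp Cnl Csu Csd)
           (uc_lp_feasible t0 t_end Pmin Pmax) (p, u, v, w)"
  shows "\<forall>t\<in>periods0 t0 t_end. u t - u (t - 1) = v t - w t"
proof (rule ballI, rule ccontr)
  fix s
  assume s: "s \<in> periods0 t0 t_end" and ne: "u s - u (s - 1) \<noteq> v s - w s"
  define v' w' where "v' = (\<lambda>t. max 0 (u t - u (t - 1)))" and "w' = (\<lambda>t. max 0 (u (t - 1) - u t))"
  let ?cost = "uc_cost f_inv u_inv t0 t_end Cp Cnl Csu Csd"
  have feas: "uc_lp_feasible t0 t_end Pmin Pmax (p, u, v, w)"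
    using assms(10) by (simp add: is_arg_min_def)
  have v': "v' t \<le> v t" and w': "w' t \<le> w t" if "t \<in> periods0 t0 t_end" for t
    using feas that by (auto simp: uc_lp_feasible_def v'_def w'_def)
  have "v' s < v s \<or> w' s < w s"
    using ne v'[OF s] w'[OF s] by (auto simp: v'_def w'_def max_def split: if_splits)
  then have "Csu * v' s + Csd * w' s < Csu * v s + Csd * w s"
    using v'[OF s] w'[OF s] \<open>Csu > 0\<close> \<open>Csd > 0\<close>
    by (auto intro: add_less_le_mono add_le_less_mono)
  then have "(\<Sum>t\<in>periods0 t0 t_end. Csu * v' t + Csd * w' t)
      < (\<Sum>t\<in>periods0 t0 t_end. Csu * v t + Csd * w t)"
    using s v' w' \<open>0 \<le> Csu\<close> \<open>0 \<le> Csd\<close>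
    by (intro sum_strict_mono_ex1)
      (auto simp: periods0_def periods_def intro!: add_mono mult_left_mono)
  then have "?cost (p, u, v', w') < ?cost (p, u, v, w)"
    by (simp add: uc_cost_def)
  moreover have "uc_lp_feasible t0 t_end Pmin Pmax (p, u, v', w')"
    unfolding v'_def w'_def using feas by (rule uc_lp_feasible_positive_parts)
  ultimately show False
    using assms(10) by (auto simp: is_arg_min_def)
qed

end
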